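(* Let $\mathbb{F}$ be a field with $\mathbb{F}\neq\mathbb{F}_2$, let $(V,Q)$ be a finite-dimensional non-degenerate quadratic space over $\mathbb{F}$, and let $f\in O(V)$ be a non-minimal isometry. Let $(\mathrm{id},f)=[\mathrm{id},f]\setminus\{\mathrm{id},f\}$ be the open interval in $O(V)$. Let $\mathcal{W}_f$ be the set of all linear subspaces $W\subseteq V$ that contain $\mathrm{Mov}(f)$ as a codimension-one subspace and are not totally singular. For $W\in\mathcal{W}_f$, let $P_{f,W}=\{g\in(\mathrm{id},f)\mid \mathrm{Mov}(g)\subseteq W\}$. Then, as a poset, $(\mathrm{id},f)$ is the disjoint union (parallel composition) of the subposets $P_{f,W}$: $$(\mathrm{id},f)=\bigsqcup_{W\in\mathcal{W}_f}P_{f,W}.$$ That is, the sets $P_{f,W}$ are pairwise disjoint with union $(\mathrm{id},f)$, and no element of $P_{f,W}$ is comparable with an element of $P_{f,W'}$ when $W\neq W'$.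
   Context: A quadratic form on a finite-dimensional vector space $V$ over $\mathbb{F}$ is a map $Q\colon V\to\mathbb{F}$ with $Q(av)=a^2Q(v)$ for $a\in\mathbb{F}$, $v\in V$, and such that the polar form $\beta(u,v)=Q(u+v)-Q(u)-Q(v)$ is bilinear; $(V,Q)$ is non-degenerate if $\beta$ is non-degenerate. $O(V)$ is the group of $f\in\mathrm{GL}(V)$ with $Q(f(u))=Q(u)$ for all $u$ (isometries). A reflection is an isometry $r_v(u)=u-\frac{\beta(u,v)}{Q(v)}v$ with $Q(v)\neq0$. A subspace $W$ is totally singular if $Q(u)=0$ for all $u\in W$. The moved space of $f\in O(V)$ is $\mathrm{Mov}(f)=\mathrm{im}(\mathrm{id}-f)$. Since $\mathbb{F}\ne\mathbb{F}_2$, every isometry is a product of reflections; $l(f)$ denotes the minimal number of reflections in such a product. The partial order on $O(V)$ is: $g\le f$ iff $l(f)=l(g)+l(g^{-1}f)$, and $[\mathrm{id},f]=\{h\in O(V)\mid \mathrm{id}\le h\le f\}$. An isometry $f$ is minimal if $l(f)=\dim\mathrm{Mov}(f)$ (equivalently, $f=\mathrm{id}$ or $\mathrm{Mov}(f)$ is not totally singular), and non-minimal otherwise. *)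

theory Defs
  imports Complex_Main "HOL-Library.Disjoint_Sets"
begin

definition polar_form :: "('v::ab_group_add \<Rightarrow> 'a::field) \<Rightarrow> 'v \<Rightarrow> 'v \<Rightarrow> 'a" where
  "polar_form Q u v = Q (u + v) - Q u - Q v"

(* The vector space V is the whole type 'v; Basis only witnesses finite dimension, and
   nothing below depends on it. *)
locale quadratic_space = finite_dimensional_vector_space scale Basis
  for scale :: "'a::field \<Rightarrow> 'v::ab_group_add \<Rightarrow> 'v" and Basis :: "'v set" +
  fixes Q :: "'v \<Rightarrow> 'a"
  assumes Q_scale: "Q (scale a v) = a ^ 2 * Q v"
    and polar_linear_right: "Vector_Spaces.linear scale (*) (\<lambda>v. polar_form Q u v)"
    and polar_linear_left: "Vector_Spaces.linear scale (*) (\<lambda>u. polar_form Q u v)"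

locale nondegenerate_quadratic_space = quadratic_space +
  assumes nondegenerate: "(\<And>v. polar_form Q u v = 0) \<Longrightarrow> u = 0"

definition orthogonal_group ::
    "('a::field \<Rightarrow> 'v::ab_group_add \<Rightarrow> 'v) \<Rightarrow> ('v \<Rightarrow> 'a) \<Rightarrow> ('v \<Rightarrow> 'v) set" where
  "orthogonal_group scale Q =
     {f. Vector_Spaces.linear scale scale f \<and> bij f \<and> (\<forall>u. Q (f u) = Q u)}"

definition reflection ::
    "('a::field \<Rightarrow> 'v::ab_group_add \<Rightarrow> 'v) \<Rightarrow> ('v \<Rightarrow> 'a) \<Rightarrow> 'v \<Rightarrow> 'v \<Rightarrow> 'v" where
  "reflection scale Q v u = u - scale (polar_form Q u v / Q v) v"

definition reflections ::
    "('a::field \<Rightarrow> 'v::ab_group_add \<Rightarrow> 'v) \<Rightarrow> ('v \<Rightarrow> 'a) \<Rightarrow> ('v \<Rightarrow> 'v) set" where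
  "reflections scale Q = {reflection scale Q v | v. Q v \<noteq> 0}"

(* LEAST is meaningful only if some factorization exists; over a field other than the
   two-element one every isometry has one (the identity is the empty product). *)
definition reflection_length ::
    "('a::field \<Rightarrow> 'v::ab_group_add \<Rightarrow> 'v) \<Rightarrow> ('v \<Rightarrow> 'a) \<Rightarrow> ('v \<Rightarrow> 'v) \<Rightarrow> nat" where
  "reflection_length scale Q f =
     (LEAST n. \<exists>rs. length rs = n \<and> set rs \<subseteq> reflections scale Q \<and> f = foldr (\<circ>) rs id)"

definition refl_le ::
    "('a::field \<Rightarrow> 'v::ab_group_add \<Rightarrow> 'v) \<Rightarrow> ('v \<Rightarrow> 'a) \<Rightarrow> ('v \<Rightarrow> 'v) \<Rightarrow> ('v \<Rightarrow> 'v) \<Rightarrow> bool" where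
  "refl_le scale Q g f \<longleftrightarrow>
     reflection_length scale Q f = reflection_length scale Q g + reflection_length scale Q (inv g \<circ> f)"

definition closed_interval ::
    "('a::field \<Rightarrow> 'v::ab_group_add \<Rightarrow> 'v) \<Rightarrow> ('v \<Rightarrow> 'a) \<Rightarrow> ('v \<Rightarrow> 'v) \<Rightarrow> ('v \<Rightarrow> 'v) set" where
  "closed_interval scale Q f =
     {h \<in> orthogonal_group scale Q. refl_le scale Q id h \<and> refl_le scale Q h f}"

definition open_interval ::
    "('a::field \<Rightarrow> 'v::ab_group_add \<Rightarrow> 'v) \<Rightarrow> ('v \<Rightarrow> 'a) \<Rightarrow> ('v \<Rightarrow> 'v) \<Rightarrow> ('v \<Rightarrow> 'v) set" where
  "open_interval scale Q f = closed_interval scale Q f - {id, f}"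

definition Mov :: "('v::ab_group_add \<Rightarrow> 'v) \<Rightarrow> 'v set" where
  "Mov f = range (\<lambda>u. u - f u)"

definition minimal_isometry ::
    "('a::field \<Rightarrow> 'v::ab_group_add \<Rightarrow> 'v) \<Rightarrow> ('v \<Rightarrow> 'a) \<Rightarrow> ('v \<Rightarrow> 'v) \<Rightarrow> bool" where
  "minimal_isometry scale Q f \<longleftrightarrow>
     f \<in> orthogonal_group scale Q \<and> reflection_length scale Q f = vector_space.dim scale (Mov f)"

definition totally_singular :: "('v \<Rightarrow> 'a::field) \<Rightarrow> 'v set \<Rightarrow> bool" where
  "totally_singular Q W \<longleftrightarrow> (\<forall>u\<in>W. Q u = 0)"

definition W_set ::
    "('a::field \<Rightarrow> 'v::ab_group_add \<Rightarrow> 'v) \<Rightarrow> ('v \<Rightarrow> 'a) \<Rightarrow> ('v \<Rightarrow> 'v) \<Rightarrow> 'v set set" where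
  "W_set scale Q f =
     {W. module.subspace scale W \<and> Mov f \<subseteq> W \<and>
         vector_space.dim scale W = vector_space.dim scale (Mov f) + 1 \<and>
         \<not> totally_singular Q W}"

definition P_set ::
    "('a::field \<Rightarrow> 'v::ab_group_add \<Rightarrow> 'v) \<Rightarrow> ('v \<Rightarrow> 'a) \<Rightarrow> ('v \<Rightarrow> 'v) \<Rightarrow> 'v set \<Rightarrow> ('v \<Rightarrow> 'v) set" where
  "P_set scale Q f W = {g \<in> open_interval scale Q f. Mov g \<subseteq> W}"

end

theory Submission imports Defs begin

text \<open>By Scherk's theorem an isometry other than the identity has length \<open>dim (Mov f)\<close> if \<open>Mov f\<close>
  is not totally singular and \<open>dim (Mov f) + 2\<close> otherwise; the key fact is that the moved space of
  a product of reflections in linearly independent vectors is the span of these vectors. If \<open>f\<close> is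
  non-minimal, the vectors of a shortest factorization therefore span a space \<open>W\<close> with
  \<open>dim W = dim (Mov f) + 1\<close>, and every \<open>g\<close> obtained as an initial segment has
  \<open>Mov g \<subseteq> W\<close>. Counting dimensions, every \<open>g\<close> strictly between \<open>id\<close> and
  \<open>f\<close> is minimal. So \<open>Mov g\<close> is not totally singular and cannot lie in two distinct spaces
  \<open>W\<close>, whose intersection is \<open>Mov f\<close>; since \<open>g \<le> h\<close> gives \<open>Mov g \<subseteq> Mov h\<close>,
  comparable elements belong to the same \<open>W\<close>.\<close>

section \<open>Polar form and isometries\<close>

context quadratic_space
begin

abbreviation isometries ("\<O>") where "\<O> \<equiv> orthogonal_group scale Q"
abbreviation polar ("\<beta>") where "\<beta> \<equiv> polar_form Q"
abbreviation refl ("\<rho>") where "\<rho> \<equiv> reflection scale Q"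
abbreviation refl_length ("\<ell>") where "\<ell> \<equiv> reflection_length scale Q"

text \<open>Indexing by vectors instead of maps makes the span and the dimension of the factors
  available.\<close>

definition refl_prod :: "'v list \<Rightarrow> 'v \<Rightarrow> 'v" where
  "refl_prod vs = foldr (\<circ>) (map \<rho> vs) id"

lemma refl_prod_simps [simp]:
  "refl_prod [] = id" "refl_prod (v # vs) = \<rho> v \<circ> refl_prod vs"
  by (simp_all add: refl_prod_def)

lemma polar_bilinear:
  "\<beta> (x + y) z = \<beta> x z + \<beta> y z" "\<beta> z (x + y) = \<beta> z x + \<beta> z y"
  "\<beta> (x - y) z = \<beta> x z - \<beta> y z" "\<beta> z (x - y) = \<beta> z x - \<beta> z y"
  "\<beta> (scale c x) z = c * \<beta> x z" "\<beta> z (scale c x) = c * \<beta> z x"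
  "\<beta> 0 z = 0" "\<beta> z 0 = 0"
proof -
  interpret l: Vector_Spaces.linear scale "(*)" "\<lambda>u. \<beta> u z" by (rule polar_linear_left)
  interpret r: Vector_Spaces.linear scale "(*)" "\<lambda>u. \<beta> z u" by (rule polar_linear_right)
  show "\<beta> (x + y) z = \<beta> x z + \<beta> y z" "\<beta> (x - y) z = \<beta> x z - \<beta> y z"
    "\<beta> (scale c x) z = c * \<beta> x z" "\<beta> 0 z = 0"
    by (simp_all add: l.add l.diff l.scale l.zero)
  show "\<beta> z (x + y) = \<beta> z x + \<beta> z y" "\<beta> z (x - y) = \<beta> z x - \<beta> z y"
    "\<beta> z (scale c x) = c * \<beta> z x" "\<beta> z 0 = 0"
    by (simp_all add: r.add r.diff r.scale r.zero)
qed

lemma polar_commute: "\<beta> x y = \<beta> y x"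
  by (simp add: polar_form_def add.commute)

lemma Q_zero: "Q 0 = 0"
  using Q_scale[of 0 0] by simp

lemma Q_add: "Q (x + y) = Q x + Q y + \<beta> x y"
  by (simp add: polar_form_def)

lemma Q_minus: "Q (- x) = Q x"
  using Q_scale[of "-1" x] by simp

lemma Q_diff: "Q (x - y) = Q x + Q y - \<beta> x y"
  using Q_add[of "x - y" y] Q_add[of x "- y"] polar_bilinear(3)[of 0 y x]
  by (simp add: Q_minus polar_bilinear polar_commute)

lemma polar_self: "\<beta> x x = 2 * Q x"
  using Q_diff[of x x] by (simp add: Q_zero)

lemma isometry_linear:
  assumes "f \<in> \<O>"
  shows "f (x + y) = f x + f y" "f (x - y) = f x - f y" "f (scale c x) = scale c (f x)" "f 0 = 0"
proof -
  interpret Vector_Spaces.linear scale scale f using assms by (simp add: orthogonal_group_def)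
  show "f (x + y) = f x + f y" "f (x - y) = f x - f y" "f (scale c x) = scale c (f x)" "f 0 = 0"
    by (simp_all add: add diff scale zero)
qed

lemma isometry_bij: "f \<in> \<O> \<Longrightarrow> bij f"
  by (simp add: orthogonal_group_def)

lemma isometry_Q: "f \<in> \<O> \<Longrightarrow> Q (f x) = Q x"
  by (simp add: orthogonal_group_def)

lemma isometryI:
  assumes "\<And>x y. f (x + y) = f x + f y" "\<And>c x. f (scale c x) = scale c (f x)"
    "bij f" "\<And>x. Q (f x) = Q x"
  shows "f \<in> \<O>"
  unfolding orthogonal_group_def Vector_Spaces.linear_iff
  using assms vector_space_axioms by blast

lemma isometry_polar: "f \<in> \<O> \<Longrightarrow> \<beta> (f x) (f y) = \<beta> x y"
  by (simp add: polar_form_def isometry_Q flip: isometry_linear)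

lemma isometry_id: "id \<in> \<O>"
  by (rule isometryI) auto

lemma isometry_comp: "f \<in> \<O> \<Longrightarrow> g \<in> \<O> \<Longrightarrow> f \<circ> g \<in> \<O>"
  by (rule isometryI) (auto simp: isometry_linear isometry_Q isometry_bij bij_comp)

lemma isometry_inv:
  assumes "f \<in> \<O>" shows "inv f \<in> \<O>"
proof -
  have f: "f (inv f x) = x" "inv f (f x) = x" for x
    using isometry_bij[OF assms] by (simp_all add: bij_is_surj surj_f_inv_f bij_is_inj)
  show ?thesis
  proof (rule isometryI)
    show "inv f (x + y) = inv f x + inv f y" for x y
      by (metis f isometry_linear(1)[OF assms])
    show "inv f (scale c x) = scale c (inv f x)" for c x
      by (metis f isometry_linear(3)[OF assms])
    show "bij (inv f)" by (rule bij_imp_bij_inv[OF isometry_bij[OF assms]])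
    show "Q (inv f x) = Q x" for x by (metis f isometry_Q[OF assms])
  qed
qed

section \<open>Reflections and their products\<close>

lemma reflection_involution:
  assumes "Q v \<noteq> 0" shows "\<rho> v (\<rho> v x) = x"
  using assms by (simp add: reflection_def polar_bilinear polar_self diff_divide_distrib scale_left_diff_distrib)

lemma reflection_comp_self: "Q v \<noteq> 0 \<Longrightarrow> \<rho> v \<circ> \<rho> v = id"
  by (simp add: fun_eq_iff reflection_involution)

lemma reflection_isometry:
  assumes "Q v \<noteq> 0" shows "\<rho> v \<in> \<O>"
proof (rule isometryI)
  show "bij (\<rho> v)"
    by (rule o_bij[where g = "\<rho> v"]) (simp_all add: reflection_comp_self assms)
  show "Q (\<rho> v x) = Q x" for x
    using assms by (simp add: reflection_def Q_diff Q_scale polar_bilinear power2_eq_square)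
qed (simp_all add: reflection_def polar_bilinear algebra_simps add_divide_distrib scale_left_distrib)

lemma refl_prod_isometry: "\<forall>v\<in>set vs. Q v \<noteq> 0 \<Longrightarrow> refl_prod vs \<in> \<O>"
  by (induction vs) (use isometry_id in \<open>auto intro!: isometry_comp reflection_isometry\<close>)

lemma refl_prod_append: "refl_prod (us @ vs) = refl_prod us \<circ> refl_prod vs"
  by (induction us) (simp_all add: comp_assoc)

section \<open>Moved spaces\<close>

lemma mem_Mov: "x \<in> Mov f \<longleftrightarrow> (\<exists>a. x = a - f a)"
  by (auto simp: Mov_def)

lemma Mov_memI: "a - f a \<in> Mov f"
  by (auto simp: Mov_def)

lemma subspace_Mov:
  assumes "f \<in> \<O>" shows "subspace (Mov f)"
proof (rule subspaceI)
  show "0 \<in> Mov f" using Mov_memI[of 0 f] by (simp add: isometry_linear(4)[OF assms])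
next
  fix x y assume "x \<in> Mov f" "y \<in> Mov f"
  then obtain a b where "x = a - f a" "y = b - f b" by (auto simp: mem_Mov)
  then have "x + y = (a + b) - f (a + b)" by (simp add: isometry_linear[OF assms])
  then show "x + y \<in> Mov f" by (auto simp: mem_Mov)
next
  fix c x assume "x \<in> Mov f"
  then obtain a where "x = a - f a" by (auto simp: mem_Mov)
  then have "scale c x = scale c a - f (scale c a)"
    by (simp add: isometry_linear[OF assms] scale_right_diff_distrib)
  then show "scale c x \<in> Mov f" by (auto simp: mem_Mov)
qed

lemma Mov_id: "Mov id = {0}"
  by (auto simp: Mov_def)

lemma Mov_comp_subset: "Mov (g \<circ> h) \<subseteq> span (Mov g \<union> Mov h)"
proof
  fix x assume "x \<in> Mov (g \<circ> h)"
  then obtain a where "x = a - g (h a)" by (auto simp: mem_Mov)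
  then have "x = (a - h a) + (h a - g (h a))" by simp
  then show "x \<in> span (Mov g \<union> Mov h)"
    by (metis Mov_memI UnI1 UnI2 span_add span_base)
qed

lemma dim_Un_le:
  assumes "subspace A" "subspace B" shows "dim (A \<union> B) \<le> dim A + dim B"
proof -
  have "span (A \<union> B) = {x + y |x y. x \<in> A \<and> y \<in> B}"
    using assms by (simp add: span_Un span_eq_iff[THEN iffD2])
  then have "dim (A \<union> B) = dim {x + y |x y. x \<in> A \<and> y \<in> B}" by (metis dim_span)
  then show ?thesis using dim_sums_Int[OF assms] by linarith
qed

lemma dim_Mov_comp_le:
  assumes "g \<in> \<O>" "h \<in> \<O>" shows "dim (Mov (g \<circ> h)) \<le> dim (Mov g) + dim (Mov h)"
  by (metis Mov_comp_subset dim_Un_le[OF subspace_Mov subspace_Mov] assms dim_span dim_subset le_trans)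

text \<open>The bound leaves no room in the inclusion of \<open>Mov (g \<circ> h)\<close> in the sum
  of the two moved spaces, so it is an equality. This is how additivity of lengths becomes inclusion
  of moved spaces.\<close>

lemma Mov_factors_subset:
  assumes "g \<in> \<O>" "h \<in> \<O>" and le: "dim (Mov g) + dim (Mov h) \<le> dim (Mov (g \<circ> h))"
  shows "Mov g \<subseteq> Mov (g \<circ> h)" "Mov h \<subseteq> Mov (g \<circ> h)"
proof -
  have "dim (span (Mov g \<union> Mov h)) \<le> dim (Mov (g \<circ> h))"
    using dim_Un_le[OF subspace_Mov subspace_Mov, OF assms(1,2)] le by simp
  then have "Mov (g \<circ> h) = span (Mov g \<union> Mov h)"
    by (intro subspace_dim_equal subspace_Mov isometry_comp assms subspace_span Mov_comp_subset)
  then show "Mov g \<subseteq> Mov (g \<circ> h)" "Mov h \<subseteq> Mov (g \<circ> h)"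
    using span_superset by blast+
qed

lemma Mov_reflection_comp_subset: "Mov (\<rho> v \<circ> f) \<subseteq> span (insert v (Mov f))"
proof
  fix x assume "x \<in> Mov (\<rho> v \<circ> f)"
  then obtain a where "x = a - \<rho> v (f a)" by (auto simp: mem_Mov)
  then have "x = (a - f a) + scale (\<beta> (f a) v / Q v) v" by (simp add: reflection_def)
  then show "x \<in> span (insert v (Mov f))"
    by (simp add: span_add span_base span_scale Mov_memI)
qed

lemma Mov_refl_prod_subset: "Mov (refl_prod vs) \<subseteq> span (set vs)"
proof (induction vs)
  case (Cons v vs)
  have "insert v (Mov (refl_prod vs)) \<subseteq> span (set (v # vs))"
    using subset_trans[OF Cons.IH span_mono[of "set vs" "set (v # vs)"]]
      span_base[of v "set (v # vs)"] by auto
  then have "span (insert v (Mov (refl_prod vs))) \<subseteq> span (set (v # vs))"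
    by (simp add: span_minimal)
  then show ?case
    using subset_trans[OF Mov_reflection_comp_subset] unfolding refl_prod_simps by blast
qed (unfold refl_prod_simps Mov_id, simp)

lemma dim_set_le: "dim (set vs) \<le> length vs"
  by (meson List.finite_set card_length dim_le_card dual_order.trans span_superset)

text \<open>The form \<open>\<beta> a (b - f b)\<close> is the Wall form of \<open>f\<close> on \<open>Mov f\<close>, lifted along
  \<open>a \<mapsto> a - f a\<close> to the whole space so that no choice of preimages is needed.\<close>

lemma wall_form_diag:
  assumes "f \<in> \<O>" shows "\<beta> a (a - f a) = Q (a - f a)"
  by (simp add: Q_diff polar_bilinear polar_self isometry_Q[OF assms])

text \<open>Invariance of the polar form turns \<open>\<beta> (f a) (p - f p)\<close> into
  \<open>- \<beta> p (a - f a)\<close>. Composing with the reflection thus projects displacements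
  along \<open>p - f p\<close> onto the right complement of \<open>p\<close> under the Wall
  form.\<close>

lemma reflection_comp_displacement:
  assumes f: "f \<in> \<O>" and Q: "Q (p - f p) \<noteq> 0"
  shows "a - (\<rho> (p - f p) \<circ> f) a = (a - f a) - scale (\<beta> p (a - f a) / Q (p - f p)) (p - f p)"
proof -
  have "\<beta> (f a) (p - f p) = - \<beta> p (a - f a)"
    by (simp add: polar_bilinear isometry_polar[OF f] polar_commute)
  then show ?thesis by (simp add: reflection_def)
qed

text \<open>All new displacements are killed by \<open>\<beta> p\<close>, whereas
  \<open>\<beta> p (p - f p) = Q (p - f p)\<close> is nonzero.\<close>

lemma Mov_reflection_comp_psubset:
  assumes f: "f \<in> \<O>" and Q: "Q (p - f p) \<noteq> 0"
  shows "Mov (\<rho> (p - f p) \<circ> f) \<subset> Mov f"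
proof -
  let ?g = "\<rho> (p - f p) \<circ> f"
  have "Mov ?g \<subseteq> Mov f"
  proof
    fix x assume "x \<in> Mov ?g"
    then obtain a where "x = (a - f a) - scale (\<beta> p (a - f a) / Q (p - f p)) (p - f p)"
      using reflection_comp_displacement[OF assms] unfolding mem_Mov by metis
    then show "x \<in> Mov f"
      by (metis Mov_memI subspace_Mov[OF f] subspace_diff subspace_scale)
  qed
  moreover have "p - f p \<notin> Mov ?g"
  proof
    assume "p - f p \<in> Mov ?g"
    then obtain a where "p - f p = (a - f a) - scale (\<beta> p (a - f a) / Q (p - f p)) (p - f p)"
      using reflection_comp_displacement[OF assms] unfolding mem_Mov by metis
    then have "\<beta> p (p - f p) = \<beta> p ((a - f a) - scale (\<beta> p (a - f a) / Q (p - f p)) (p - f p))"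
      by simp
    also have "\<dots> = \<beta> p (a - f a) - (\<beta> p (a - f a) / Q (p - f p)) * \<beta> p (p - f p)"
      by (simp only: polar_bilinear)
    also have "\<dots> = 0" using Q by (simp only: wall_form_diag[OF f]) simp
    finally show False using Q by (simp add: wall_form_diag[OF f])
  qed
  ultimately show ?thesis using Mov_memI[of p f] by blast
qed

lemma dim_Mov_reflection_comp_less:
  assumes f: "f \<in> \<O>" and Q: "Q (p - f p) \<noteq> 0"
  shows "dim (Mov (\<rho> (p - f p) \<circ> f)) < dim (Mov f)"
  using Mov_reflection_comp_psubset[OF assms]
  by (intro dim_psubset) (simp add: span_eq_iff[THEN iffD2] subspace_Mov isometry_comp reflection_isometry f Q)

end

section \<open>Consequences of non-degeneracy for moved spaces\<close>

context nondegenerate_quadratic_space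
begin

text \<open>Gaussian elimination by induction on \<open>S\<close>. If everything orthogonal to
  \<open>S\<close> is orthogonal to \<open>w\<close> too, the vector for \<open>S\<close> already
  works; otherwise some \<open>a0\<close> serves to correct it.\<close>

lemma orthogonal_separation:
  assumes "finite S" "v \<notin> span S"
  shows "\<exists>a. (\<forall>w\<in>S. \<beta> a w = 0) \<and> \<beta> a v \<noteq> 0"
  using assms
proof (induction S arbitrary: v rule: finite_induct)
  case empty
  then show ?case using nondegenerate[of v] by (auto simp: polar_commute)
next
  case (insert w S)
  show ?case
  proof (cases "\<exists>a0. (\<forall>u\<in>S. \<beta> a0 u = 0) \<and> \<beta> a0 w \<noteq> 0")
    case False
    moreover have "v \<notin> span S" using insert.prems span_mono[of S "insert w S"] by auto
    ultimately show ?thesis using insert.IH[of v] by auto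
  next
    case True
    then obtain a0 where a0: "\<forall>u\<in>S. \<beta> a0 u = 0" "\<beta> a0 w \<noteq> 0" by blast
    \<comment> \<open>With this \<open>k\<close>, the corrected vector \<open>b\<close> below
      satisfies \<open>\<beta> b v = \<beta> a (v - scale k w)\<close>.\<close>
    define k where "k = \<beta> a0 v / \<beta> a0 w"
    have "v - scale k w \<notin> span S"
      using insert.prems by (auto simp: span_breakdown_eq)
    then obtain a where a: "\<forall>u\<in>S. \<beta> a u = 0" "\<beta> a (v - scale k w) \<noteq> 0"
      using insert.IH by blast
    define b where "b = a - scale (\<beta> a w / \<beta> a0 w) a0"
    have "\<forall>u\<in>insert w S. \<beta> b u = 0" using a a0 by (simp add: b_def polar_bilinear)
    moreover have "\<beta> b v \<noteq> 0"
      using a(2) by (simp add: b_def k_def polar_bilinear mult.commute)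
    ultimately show ?thesis by blast
  qed
qed

lemma subspace_orthogonal_separation:
  assumes U: "subspace U" and v: "v \<notin> U"
  obtains a where "\<forall>w\<in>U. \<beta> a w = 0" "\<beta> a v \<noteq> 0"
proof -
  obtain B where B: "B \<subseteq> U" "independent B" "U \<subseteq> span B" using basis_exists[of U] by metis
  have sB: "span B = U" using B U by (simp add: span_minimal subset_antisym)
  obtain a where a: "\<forall>w\<in>B. \<beta> a w = 0" "\<beta> a v \<noteq> 0"
    using orthogonal_separation[OF finiteI_independent[OF B(2)], of v] v sB by auto
  have "subspace {w. \<beta> a w = 0}" by (auto intro!: subspaceI simp: polar_bilinear)
  then have "span B \<subseteq> {w. \<beta> a w = 0}" using a by (intro span_minimal) auto
  then show ?thesis using that a sB by blast
qed

text \<open>Since \<open>\<beta> (f a - a) (f b) = \<beta> a (b - f b)\<close>, the vector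
  \<open>f a - a\<close> is orthogonal to the range of \<open>f\<close>, which is the whole
  space.\<close>

lemma fixed_if_orthogonal_Mov:
  assumes f: "f \<in> \<O>" and a: "\<forall>w\<in>Mov f. \<beta> a w = 0"
  shows "f a = a"
proof -
  have "\<beta> (f a - a) (f b) = 0" for b
    using bspec[OF a Mov_memI[of b f]] by (simp add: polar_bilinear isometry_polar[OF f])
  then have "\<beta> (f a - a) x = 0" for x
    using isometry_bij[OF f] by (metis bij_pointE)
  then show ?thesis using nondegenerate[of "f a - a"] by simp
qed

text \<open>A vector orthogonal to \<open>Mov f\<close> but not to \<open>v\<close> is fixed by
  \<open>f\<close>, so the composition displaces it by a nonzero multiple of \<open>v\<close>. Once
  \<open>v\<close> is moved, all of \<open>Mov f\<close> is recovered.\<close>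

lemma Mov_reflection_comp:
  assumes f: "f \<in> \<O>" and Q: "Q v \<noteq> 0" and v: "v \<notin> Mov f"
  shows "Mov (\<rho> v \<circ> f) = span (insert v (Mov f))"
proof
  let ?M = "Mov (\<rho> v \<circ> f)"
  have sub: "subspace ?M" by (intro subspace_Mov isometry_comp reflection_isometry f Q)
  obtain a where a: "\<forall>w\<in>Mov f. \<beta> a w = 0" "\<beta> a v \<noteq> 0"
    using subspace_orthogonal_separation[OF subspace_Mov[OF f] v] .
  have "a - (\<rho> v \<circ> f) a = scale (\<beta> a v / Q v) v"
    using fixed_if_orthogonal_Mov[OF f a(1)] by (simp add: reflection_def)
  then have "scale (\<beta> a v / Q v) v \<in> ?M" by (metis Mov_memI)
  then have "scale (Q v / \<beta> a v) (scale (\<beta> a v / Q v) v) \<in> ?M" by (rule subspace_scale[OF sub])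
  then have vM: "v \<in> ?M" using Q a by simp
  have "b - f b \<in> ?M" for b
  proof -
    have "b - f b = (b - (\<rho> v \<circ> f) b) - scale (\<beta> (f b) v / Q v) v"
      by (simp add: reflection_def)
    then show ?thesis using vM by (metis Mov_memI sub subspace_diff subspace_scale)
  qed
  then have "insert v (Mov f) \<subseteq> ?M" using vM by (auto simp: mem_Mov)
  then show "span (insert v (Mov f)) \<subseteq> ?M" using sub by (rule span_minimal)
qed (rule Mov_reflection_comp_subset)

text \<open>The length bound encodes that the list is linearly independent and without repetition;
  each vector then lies outside the span of the later ones, and \<open>Mov_reflection_comp\<close>
  applies.\<close>

lemma Mov_refl_prod_independent:
  assumes "\<forall>v\<in>set vs. Q v \<noteq> 0" "length vs \<le> dim (set vs)"
  shows "Mov (refl_prod vs) = span (set vs)"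
  using assms
proof (induction vs)
  case (Cons v vs)
  have d: "v \<notin> span (set vs)" "length vs \<le> dim (set vs)"
    using Cons.prems(2) dim_set_le[of vs] by (auto simp: dim_insert split: if_splits)
  then have IH: "Mov (refl_prod vs) = span (set vs)" using Cons by auto
  then have "Mov (\<rho> v \<circ> refl_prod vs) = span (insert v (span (set vs)))"
    using Mov_reflection_comp[of "refl_prod vs" v] refl_prod_isometry[of vs] Cons.prems d by auto
  also have "\<dots> = span (insert v (set vs))"
    by (metis span_insert span_span)
  finally show ?case unfolding refl_prod_simps list.set .
qed (unfold refl_prod_simps Mov_id, simp)

section \<open>Scherk's theorem for moved spaces that are not totally singular\<close>

lemma wall_form_nondegenerate_left:
  assumes f: "f \<in> \<O>" and a: "a - f a \<noteq> 0" shows "\<exists>b. \<beta> a (b - f b) \<noteq> 0"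
proof -
  have "f a \<noteq> a" using a by auto
  then obtain w where "w \<in> Mov f" "\<beta> a w \<noteq> 0"
    using fixed_if_orthogonal_Mov[OF f] by blast
  then show ?thesis unfolding mem_Mov by blast
qed

lemma nondegenerate_right: "b \<noteq> 0 \<Longrightarrow> \<exists>a. \<beta> a b \<noteq> 0"
  using nondegenerate[of b] by (auto simp: polar_commute)

text \<open>Splitting off the reflection in \<open>p' - f p'\<close> leaves the displacement of
  \<open>x\<close> unchanged, so the remaining moved space is again not totally singular. The vector
  \<open>q\<close> ensures that \<open>Mov f\<close> is more than a line.\<close>

lemma scherk_pair:
  assumes F: "card (UNIV :: 'a set) \<noteq> 2" and f: "f \<in> \<O>"
    and p: "Q (p - f p) \<noteq> 0" and q: "q - f q \<notin> span {p - f p}"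
  obtains p' x where "Q (p' - f p') \<noteq> 0" "\<beta> p' (x - f x) = 0" "Q (x - f x) \<noteq> 0"
proof -
  define B where "B a b = \<beta> a (b - f b)" for a b
  have Blin: "B (a + b) c = B a c + B b c" "B c (a + b) = B c a + B c b"
    "B (a - b) c = B a c - B b c" "B c (a - b) = B c a - B c b"
    "B (scale k a) c = k * B a c" "B c (scale k a) = k * B c a" for a b c k
    by (simp_all add: B_def polar_bilinear isometry_linear[OF f] algebra_simps)
  have BQ: "Q (a - f a) = B a a" for a by (simp add: B_def wall_form_diag[OF f])
  have nl: "\<exists>b. B a b \<noteq> 0" if "a - f a \<noteq> 0" for a
    using wall_form_nondegenerate_left[OF f that] by (simp add: B_def)
  have nr: "\<exists>a. B a b \<noteq> 0" if "b - f b \<noteq> 0" for b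
    using nondegenerate_right[OF that] by (simp add: B_def)
  have Bpp: "B p p \<noteq> 0" using p by (simp add: BQ)
  show ?thesis
  proof (cases "\<exists>x. B p x = 0 \<and> B x x \<noteq> 0")
    case True
    then show ?thesis using that[of p] p unfolding BQ B_def by blast
  next
    case False
    \<comment> \<open>The right complement of \<open>p\<close> is isotropic. Perturb \<open>p\<close> by an element \<open>u\<close> of the complement
      that is also left-orthogonal to \<open>p\<close>; the complement of \<open>p + t u\<close> then contains some \<open>p + y\<close>.\<close>
    then have iso: "B x x = 0" if "B p x = 0" for x using that by blast
    have alt: "B x y = - B y x" if "B p x = 0" "B p y = 0" for x y
      using iso[of "x + y"] iso[of x] iso[of y] that by (simp add: Blin add_eq_0_iff2)
    \<comment> \<open>Projection along \<open>p\<close> onto its right complement under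
      \<open>B\<close>.\<close>
    define pr where "pr a = a - scale (B p a / B p p) p" for a
    have pr: "B p (pr a) = 0" for a using Bpp by (simp add: pr_def Blin)
    define u0 where "u0 = pr q"
    have u0: "B p u0 = 0" "u0 - f u0 \<noteq> 0"
    proof -
      show "B p u0 = 0" by (simp add: u0_def pr)
      show "u0 - f u0 \<noteq> 0"
      proof
        assume "u0 - f u0 = 0"
        then have "q - f q = scale (B p q / B p p) (p - f p)"
          by (simp add: u0_def pr_def isometry_linear[OF f] algebra_simps)
        then show False using q by (metis span_base span_scale singletonI)
      qed
    qed
    \<comment> \<open>Left-orthogonality to \<open>p\<close> keeps
      \<open>B (p + scale t u) (p + scale t u)\<close> equal to \<open>B p p\<close>. If
      \<open>u0\<close> lacks it, a vector \<open>y\<close> pairing with \<open>u0\<close> is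
      corrected by a multiple of \<open>u0\<close>; as \<open>u0\<close> is isotropic, the result
      still pairs with \<open>u0\<close> and hence is moved.\<close>
    obtain u where u: "B p u = 0" "u - f u \<noteq> 0" "B u p = 0"
    proof (cases "B u0 p = 0")
      case True then show ?thesis using that u0 by blast
    next
      case False
      obtain y0 where y0: "B y0 u0 \<noteq> 0" using nr u0 by blast
      define y where "y = pr y0"
      have y: "B p y = 0" "B y u0 \<noteq> 0" using y0 u0 by (simp_all add: y_def pr) (simp add: pr_def Blin)
      define w where "w = y - scale (B y p / B u0 p) u0"
      have w: "B p w = 0" "B w p = 0" using y u0 False by (simp_all add: w_def Blin)
      have "B w u0 \<noteq> 0" using y iso[OF u0(1)] by (simp add: w_def Blin)
      then have "B u0 w \<noteq> 0" using alt[OF w(1) u0(1)] by simp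
      then have "w - f w \<noteq> 0" by (auto simp: B_def polar_bilinear)
      then show ?thesis using that w by blast
    qed
    obtain y0 where y0: "B u y0 \<noteq> 0" using nl u by blast
    define y where "y = pr y0"
    have y: "B p y = 0" "B u y \<noteq> 0" using y0 u by (simp_all add: y_def pr) (simp add: pr_def Blin)
    \<comment> \<open>\<open>card\<close> is 0 for infinite fields, so the hypothesis provides a
      third scalar in every case. It is the fallback for \<open>s\<close> when the value 1
      fails.\<close>
    obtain c :: 'a where c: "c \<noteq> 0" "c \<noteq> 1"
    proof (rule ccontr)
      assume "\<not> thesis"
      then have "(UNIV :: 'a set) = {0, 1}" using that by auto
      then show False using F by (metis card_2_iff zero_neq_one)
    qed
    \<comment> \<open>The expression is \<open>B (p + scale s y) (p + scale s y)\<close>, because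
      \<open>B p y\<close> and \<open>B y y\<close> vanish.\<close>
    obtain s where s: "s \<noteq> 0" "B p p + s * B y p \<noteq> 0"
    proof (cases "B p p + B y p = 0")
      case False then show ?thesis using that[of 1] by simp
    next
      case True
      then have "B p p + c * B y p = (1 - c) * B p p" by algebra
      then show ?thesis using that[of c] c Bpp by simp
    qed
    \<comment> \<open>Solves \<open>B (p + scale t u) (p + scale s y) = B p p + t * s * B u y =
      0\<close> for \<open>t\<close>.\<close>
    define t where "t = - B p p / (s * B u y)"
    have t: "t * (s * B u y) = - B p p" using s y by (simp add: t_def)
    show ?thesis
    proof (rule that[of "p + scale t u" "p + scale s y"])
      show "Q ((p + scale t u) - f (p + scale t u)) \<noteq> 0"
        using u iso[OF u(1)] Bpp by (simp add: BQ Blin)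
      have "B (p + scale t u) (p + scale s y) = 0"
        using u y t by (simp add: Blin algebra_simps)
      then show "\<beta> (p + scale t u) ((p + scale s y) - f (p + scale s y)) = 0" by (simp add: B_def)
      show "Q ((p + scale s y) - f (p + scale s y)) \<noteq> 0"
        using y iso[OF y(1)] s by (simp add: BQ Blin)
    qed
  qed
qed

text \<open>Induction on the dimension: \<open>scherk_pair\<close> supplies a reflection that lowers
  it without making the moved space totally singular. If \<open>Mov f\<close> is a line,
  \<open>f\<close> is itself a reflection.\<close>

theorem scherk:
  assumes F: "card (UNIV :: 'a set) \<noteq> 2" and f: "f \<in> \<O>"
    and ns: "\<not> totally_singular Q (Mov f)"
  shows "\<exists>vs. (\<forall>v\<in>set vs. Q v \<noteq> 0) \<and> length vs \<le> dim (Mov f) \<and> f = refl_prod vs"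
  using f ns
proof (induction "dim (Mov f)" arbitrary: f rule: less_induct)
  case less
  note f = less.prems(1)
  have undo: "f = \<rho> v \<circ> (\<rho> v \<circ> f)" if "Q v \<noteq> 0" for v
    by (simp add: reflection_comp_self that flip: comp_assoc)
  obtain p where p: "Q (p - f p) \<noteq> 0"
    using less.prems(2) by (auto simp: totally_singular_def mem_Mov)
  show ?case
  proof (cases "Mov f \<subseteq> span {p - f p}")
    case False
    then obtain q where "q - f q \<notin> span {p - f p}" unfolding subset_iff mem_Mov by blast
    then obtain p' x where px: "Q (p' - f p') \<noteq> 0" "\<beta> p' (x - f x) = 0" "Q (x - f x) \<noteq> 0"
      using scherk_pair[OF F f p] by metis
    define v g where "v = p' - f p'" and "g = \<rho> v \<circ> f"
    have lt: "dim (Mov g) < dim (Mov f)"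
      using dim_Mov_reflection_comp_less[OF f px(1)] by (simp add: g_def v_def)
    have gO: "g \<in> \<O>" using px by (simp add: g_def v_def isometry_comp reflection_isometry f)
    have "x - g x = x - f x"
      using reflection_comp_displacement[OF f px(1), of x] px(2) by (simp add: g_def v_def)
    then have "x - f x \<in> Mov g" by (metis Mov_memI)
    then have "\<not> totally_singular Q (Mov g)" using px by (auto simp: totally_singular_def)
    from less.hyps[OF lt gO this] obtain vs
      where "\<forall>v\<in>set vs. Q v \<noteq> 0" "length vs \<le> dim (Mov g)" "g = refl_prod vs" by blast
    then show ?thesis using undo[of v] px lt
      by (intro exI[of _ "v # vs"]) (simp add: v_def g_def)
  next
    case True
    define v where "v = p - f p"
    have "a - (\<rho> v \<circ> f) a = 0" for a
    proof -
      obtain k where k: "a - f a = scale k v"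
        using True Mov_memI[of a f] by (auto simp: v_def span_singleton)
      then have "\<beta> p (a - f a) = k * Q v"
        by (simp add: polar_bilinear(6) v_def wall_form_diag[OF f])
      then show ?thesis
        using reflection_comp_displacement[OF f p, of a] p k by (simp add: v_def)
    qed
    then have "\<rho> v \<circ> f = id" by (simp add: fun_eq_iff)
    then have "f = refl_prod [v]" using undo[of v] p by (simp add: v_def)
    moreover have "0 < dim (Mov f)"
      using dim_Mov_reflection_comp_less[OF f p] by (rule le_less_trans[OF le0])
    ultimately show ?thesis using p by (intro exI[of _ "[v]"]) (simp add: v_def)
  qed
qed

section \<open>Totally singular moved spaces and reflection length\<close>

lemma exists_nonsingular:
  fixes v :: 'b
  assumes "v \<noteq> 0" obtains w where "Q w \<noteq> 0"
proof -
  have "\<exists>u. \<beta> v u \<noteq> 0" using assms nondegenerate[of v] by blast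
  then show ?thesis using that by (metis polar_form_def diff_self)
qed

text \<open>Any nonsingular \<open>v\<close> lies outside \<open>Mov f\<close>, so composing with
  its reflection adds one dimension and makes \<open>scherk\<close> applicable. The extra dimension
  and \<open>v\<close> itself account for the 2.\<close>

lemma totally_singular_factorization:
  assumes F: "card (UNIV :: 'a set) \<noteq> 2" and f: "f \<in> \<O>" and ts: "totally_singular Q (Mov f)"
  shows "\<exists>vs. (\<forall>v\<in>set vs. Q v \<noteq> 0) \<and> length vs \<le> dim (Mov f) + 2 \<and> f = refl_prod vs"
proof (cases "f = id")
  case True
  then show ?thesis by (intro exI[of _ "[]"]) simp
next
  case False
  then obtain a where "f a \<noteq> a" by (auto simp: fun_eq_iff)
  then obtain v where v: "Q v \<noteq> 0" using exists_nonsingular[of "a - f a"] by auto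
  define g where "g = \<rho> v \<circ> f"
  have g: "g \<in> \<O>" by (simp add: g_def isometry_comp reflection_isometry f v)
  have Mg: "Mov g = span (insert v (Mov f))"
    unfolding g_def using v ts by (intro Mov_reflection_comp f) (auto simp: totally_singular_def)
  then have "\<not> totally_singular Q (Mov g)" using v
    by (metis insertI1 span_base totally_singular_def)
  then obtain vs where vs: "\<forall>v\<in>set vs. Q v \<noteq> 0" "length vs \<le> dim (Mov g)" "g = refl_prod vs"
    using scherk[OF F g] by blast
  have "f = refl_prod (v # vs)"
    using vs(3) v by (simp add: g_def reflection_comp_self flip: comp_assoc)
                      (simp add: g_def comp_assoc[symmetric] reflection_comp_self flip: vs(3))
  moreover have "dim (Mov g) \<le> dim (Mov f) + 1" by (simp add: Mg dim_insert)
  ultimately show ?thesis using vs v by (intro exI[of _ "v # vs"]) simp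
qed

text \<open>The \<open>LEAST\<close> is attained because some factorization exists; vectors are then
  chosen for the reflections.\<close>

lemma refl_length_factorization:
  assumes F: "card (UNIV :: 'a set) \<noteq> 2" and f: "f \<in> \<O>"
  obtains vs where "\<forall>v\<in>set vs. Q v \<noteq> 0" "length vs = \<ell> f" "f = refl_prod vs"
proof -
  let ?P = "\<lambda>n. \<exists>rs. length rs = n \<and> set rs \<subseteq> reflections scale Q \<and> f = foldr (\<circ>) rs id"
  obtain us where us: "\<forall>v\<in>set us. Q v \<noteq> 0" "f = refl_prod us"
    using scherk[OF F f] totally_singular_factorization[OF F f] by blast
  then have "?P (length us)"
    by (intro exI[of _ "map \<rho> us"]) (auto simp: reflections_def refl_prod_def)
  then have "?P (\<ell> f)" unfolding reflection_length_def by (rule LeastI)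
  then obtain rs where rs: "length rs = \<ell> f" "set rs \<subseteq> reflections scale Q" "f = foldr (\<circ>) rs id"
    by blast
  then have "\<forall>r\<in>set rs. \<exists>v. r = \<rho> v \<and> Q v \<noteq> 0" by (auto simp: reflections_def)
  then obtain w where "\<forall>r\<in>set rs. r = \<rho> (w r) \<and> Q (w r) \<noteq> 0" by metis
  then have "map \<rho> (map w rs) = rs" "\<forall>v\<in>set (map w rs). Q v \<noteq> 0"
    by (auto intro!: map_idI)
  then show ?thesis using that[of "map w rs"] rs by (simp add: refl_prod_def)
qed

lemma refl_length_le: "\<forall>v\<in>set vs. Q v \<noteq> 0 \<Longrightarrow> \<ell> (refl_prod vs) \<le> length vs"
  unfolding reflection_length_def
  by (rule Least_le, rule exI[of _ "map \<rho> vs"]) (auto simp: reflections_def refl_prod_def)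

lemma dim_Mov_le_refl_length:
  assumes "card (UNIV :: 'a set) \<noteq> 2" "f \<in> \<O>" shows "dim (Mov f) \<le> \<ell> f"
proof -
  obtain vs where "length vs = \<ell> f" "f = refl_prod vs" using refl_length_factorization[OF assms] .
  then show ?thesis
    by (metis Mov_refl_prod_subset dim_set_le dim_span dim_subset le_trans)
qed

lemma refl_length_nonsingular:
  assumes "card (UNIV :: 'a set) \<noteq> 2" "f \<in> \<O>" "\<not> totally_singular Q (Mov f)"
  shows "\<ell> f = dim (Mov f)"
  using scherk[OF assms] refl_length_le dim_Mov_le_refl_length[OF assms(1,2)]
  by (metis le_antisym le_trans)

text \<open>No reflecting vector lies in a totally singular moved space, so the inclusion in the
  span is strict, and by \<open>Mov_refl_prod_independent\<close> the vectors are dependent.\<close>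

lemma singular_refl_prod:
  assumes vs: "\<forall>v\<in>set vs. Q v \<noteq> 0" and ts: "totally_singular Q (Mov (refl_prod vs))"
    and ne: "vs \<noteq> []"
  shows "dim (Mov (refl_prod vs)) < dim (set vs)" "dim (set vs) < length vs"
proof -
  let ?M = "Mov (refl_prod vs)"
  obtain v where v: "v \<in> set vs" using ne by (meson list.set_sel(1))
  then have "v \<notin> ?M" using vs ts by (auto simp: totally_singular_def)
  then have neq: "?M \<noteq> span (set vs)" using v span_base by auto
  then show "dim (set vs) < length vs"
    using Mov_refl_prod_independent[OF vs] by linarith
  have "?M \<subset> span (set vs)" using neq Mov_refl_prod_subset by blast
  then show "dim ?M < dim (set vs)"
    using subspace_Mov[OF refl_prod_isometry[OF vs]] by (intro dim_psubset) (simp add: span_eq_iff[THEN iffD2])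
qed

lemma refl_length_singular:
  assumes F: "card (UNIV :: 'a set) \<noteq> 2" and f: "f \<in> \<O>" "f \<noteq> id"
    and ts: "totally_singular Q (Mov f)"
  shows "\<ell> f = dim (Mov f) + 2"
proof (rule antisym)
  show "\<ell> f \<le> dim (Mov f) + 2"
    using totally_singular_factorization[OF F f(1) ts] refl_length_le le_trans by blast
  obtain vs where vs: "\<forall>v\<in>set vs. Q v \<noteq> 0" "length vs = \<ell> f" "f = refl_prod vs"
    using refl_length_factorization[OF F f(1)] .
  moreover have "vs \<noteq> []" using vs(3) f(2) by auto
  ultimately show "dim (Mov f) + 2 \<le> \<ell> f"
    using singular_refl_prod[of vs] ts by fastforce
qed

lemma refl_length_id: "\<ell> id = 0"
  using refl_length_le[of "[]"] by simp

end

section \<open>The open interval below a non-minimal isometry\<close>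

locale non_minimal_isometry = nondegenerate_quadratic_space +
  fixes f
  assumes not_F2: "card (UNIV :: 'a set) \<noteq> 2"
    and isometry: "f \<in> \<O>"
    and non_minimal: "\<not> minimal_isometry scale Q f"
begin

lemma singular: "totally_singular Q (Mov f)"
  using non_minimal refl_length_nonsingular[OF not_F2 isometry] isometry
  by (auto simp: minimal_isometry_def)

lemma not_id: "f \<noteq> id"
  using non_minimal isometry by (auto simp: minimal_isometry_def refl_length_id Mov_id)

lemma length_eq: "\<ell> f = dim (Mov f) + 2"
  by (rule refl_length_singular[OF not_F2 isometry not_id singular])

lemma comp_inv_cancel:
  assumes "g \<in> \<O>" shows "g \<circ> (inv g \<circ> h) = h"
  using isometry_bij[OF assms] by (simp add: fun_eq_iff bij_is_surj surj_f_inv_f)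

lemma open_interval_iff:
  "g \<in> open_interval scale Q f \<longleftrightarrow>
    g \<in> \<O> \<and> g \<noteq> id \<and> g \<noteq> f \<and> \<ell> f = \<ell> g + \<ell> (inv g \<circ> f)"
  by (auto simp: open_interval_def closed_interval_def refl_le_def refl_length_id)

text \<open>Otherwise \<open>g\<close> uses up the whole surplus of 2 in the length of
  \<open>f\<close>. Then \<open>Mov h\<close> lies in \<open>Mov f\<close> for the cofactor
  \<open>h\<close>, so it is totally singular; having no surplus, \<open>h\<close> is the identity
  and \<open>g = f\<close>.\<close>

lemma open_interval_nonsingular:
  assumes "g \<in> open_interval scale Q f" shows "\<not> totally_singular Q (Mov g)"
proof
  assume ts: "totally_singular Q (Mov g)"
  define h where "h = inv g \<circ> f"
  have g: "g \<in> \<O>" "g \<noteq> id" "g \<noteq> f" and l: "\<ell> f = \<ell> g + \<ell> h"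
    using assms by (auto simp: open_interval_iff h_def)
  have h: "h \<in> \<O>" by (simp add: h_def isometry_comp isometry_inv g isometry)
  have f_eq: "g \<circ> h = f" by (simp add: h_def comp_inv_cancel g)
  have "dim (Mov f) = dim (Mov g) + \<ell> h"
    using l length_eq refl_length_singular[OF not_F2 g(1,2) ts] by simp
  then have eq: "dim (Mov h) = \<ell> h" "dim (Mov g) + dim (Mov h) \<le> dim (Mov f)"
    using dim_Mov_comp_le[OF g(1) h] dim_Mov_le_refl_length[OF not_F2 h] f_eq by auto
  then have "Mov h \<subseteq> Mov f" using Mov_factors_subset(2)[OF g(1) h] f_eq by simp
  then have "totally_singular Q (Mov h)" using singular by (auto simp: totally_singular_def)
  then have "h = id" using refl_length_singular[OF not_F2 h] eq(1) by fastforce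
  then show False using f_eq g(3) by simp
qed

text \<open>Shortest factorizations of \<open>g\<close> and of \<open>inv g \<circ> f\<close>
  concatenate to a shortest one of \<open>f\<close>, whose vectors span the required
  \<open>W\<close>.\<close>

lemma open_interval_cover:
  assumes "g \<in> open_interval scale Q f" shows "\<exists>W\<in>W_set scale Q f. Mov g \<subseteq> W"
proof -
  define h where "h = inv g \<circ> f"
  have g: "g \<in> \<O>" and l: "\<ell> f = \<ell> g + \<ell> h"
    using assms by (auto simp: open_interval_iff h_def)
  have h: "h \<in> \<O>" by (simp add: h_def isometry_comp isometry_inv g isometry)
  obtain us where us: "\<forall>v\<in>set us. Q v \<noteq> 0" "length us = \<ell> g" "g = refl_prod us"
    using refl_length_factorization[OF not_F2 g] .
  obtain vs where vs: "\<forall>v\<in>set vs. Q v \<noteq> 0" "length vs = \<ell> h" "h = refl_prod vs"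
    using refl_length_factorization[OF not_F2 h] .
  define W where "W = span (set (us @ vs))"
  have Q: "\<forall>v\<in>set (us @ vs). Q v \<noteq> 0" using us vs by auto
  have f_eq: "f = refl_prod (us @ vs)"
    using comp_inv_cancel[OF g, of f] us(3) vs(3) unfolding h_def[symmetric] refl_prod_append by metis
  have ne: "us @ vs \<noteq> []" using f_eq not_id by auto
  \<comment> \<open>\<open>singular_refl_prod\<close> puts \<open>dim W\<close> strictly between
    \<open>dim (Mov f)\<close> and the length \<open>dim (Mov f) + 2\<close>.\<close>
  have "dim W = dim (Mov f) + 1"
    using singular_refl_prod[OF Q _ ne] singular f_eq us(2) vs(2) l length_eq by (simp add: W_def)
  moreover have "Mov f \<subseteq> W" unfolding W_def f_eq by (rule Mov_refl_prod_subset)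
  moreover have "\<not> totally_singular Q W"
    unfolding W_def totally_singular_def using Q ne by (metis list.set_sel(1) span_base)
  ultimately have "W \<in> W_set scale Q f" by (simp add: W_set_def W_def)
  moreover have "Mov g \<subseteq> W"
    using Mov_refl_prod_subset[of us] span_mono[of "set us" "set (us @ vs)"] us(3) by (auto simp: W_def)
  ultimately show ?thesis by blast
qed

lemma W_set_Int:
  assumes "W \<in> W_set scale Q f" "W' \<in> W_set scale Q f" "W \<noteq> W'" shows "W \<inter> W' = Mov f"
proof -
  have W: "subspace W" "Mov f \<subseteq> W" "dim W = dim (Mov f) + 1"
    and W': "subspace W'" "Mov f \<subseteq> W'" "dim W' = dim (Mov f) + 1"
    using assms by (auto simp: W_set_def)
  have sI: "subspace (W \<inter> W')" by (rule subspace_inter[OF W(1) W'(1)])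
  have "\<not> dim W \<le> dim (W \<inter> W')"
  proof
    assume "dim W \<le> dim (W \<inter> W')"
    then have "W \<inter> W' = W" "W \<inter> W' = W'"
      using subspace_dim_equal[OF sI W(1)] subspace_dim_equal[OF sI W'(1)] W(3) W'(3) by auto
    then show False using assms(3) by simp
  qed
  then have "Mov f = W \<inter> W'"
    using W W' by (intro subspace_dim_equal subspace_Mov isometry sI) auto
  then show ?thesis by simp
qed

lemma P_set_disjoint:
  assumes "W \<in> W_set scale Q f" "W' \<in> W_set scale Q f" "W \<noteq> W'"
    and "g \<in> open_interval scale Q f" "Mov g \<subseteq> W" "Mov g \<subseteq> W'"
  shows False
proof -
  have "Mov g \<subseteq> Mov f" using W_set_Int[OF assms(1-3)] assms(5,6) by auto
  then have "totally_singular Q (Mov g)" using singular by (auto simp: totally_singular_def)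
  then show False using open_interval_nonsingular[OF assms(4)] by simp
qed

text \<open>For \<open>g\<close> and \<open>h\<close> length equals dimension by
  \<open>open_interval_nonsingular\<close>, so the order relation gives the dimension bound that
  \<open>Mov_factors_subset\<close> needs.\<close>

lemma Mov_mono_open_interval:
  assumes g: "g \<in> open_interval scale Q f" and h: "h \<in> open_interval scale Q f"
    and le: "refl_le scale Q g h"
  shows "Mov g \<subseteq> Mov h"
proof -
  define k where "k = inv g \<circ> h"
  have O: "g \<in> \<O>" "h \<in> \<O>" using g h by (auto simp: open_interval_iff)
  have k: "k \<in> \<O>" by (simp add: k_def isometry_comp isometry_inv O)
  have h_eq: "g \<circ> k = h" by (simp add: k_def comp_inv_cancel O)
  have "\<ell> h = \<ell> g + \<ell> k" using le by (simp add: refl_le_def k_def)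
  then have "dim (Mov h) = dim (Mov g) + \<ell> k"
    using refl_length_nonsingular[OF not_F2] O open_interval_nonsingular g h by metis
  then show ?thesis
    using Mov_factors_subset(1)[OF O(1) k] h_eq dim_Mov_le_refl_length[OF not_F2 k] by simp
qed

end

theorem theorem3p10:
  fixes scale :: "'a::field \<Rightarrow> 'v::ab_group_add \<Rightarrow> 'v"
    and Basis :: "'v set"
    and Q :: "'v \<Rightarrow> 'a"
    and f :: "'v \<Rightarrow> 'v"
  assumes not_F2: "card (UNIV :: 'a set) \<noteq> 2"
    and V: "nondegenerate_quadratic_space scale Basis Q"
    and f: "f \<in> orthogonal_group scale Q"
    and non_minimal: "\<not> minimal_isometry scale Q f"
  shows "open_interval scale Q f = (\<Union>W\<in>W_set scale Q f. P_set scale Q f W)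
    \<and> disjoint_family_on (P_set scale Q f) (W_set scale Q f)
    \<and> (\<forall>W\<in>W_set scale Q f. \<forall>W'\<in>W_set scale Q f. W \<noteq> W' \<longrightarrow>
         (\<forall>g\<in>P_set scale Q f W. \<forall>h\<in>P_set scale Q f W'.
            \<not> refl_le scale Q g h \<and> \<not> refl_le scale Q h g))"
proof -
  interpret nondegenerate_quadratic_space scale Basis Q by (rule V)
  interpret non_minimal_isometry scale Basis Q f
    by unfold_locales (use not_F2 f non_minimal in auto)
  have "open_interval scale Q f = (\<Union>W\<in>W_set scale Q f. P_set scale Q f W)"
    using open_interval_cover by (auto simp: P_set_def)
  moreover have "disjoint_family_on (P_set scale Q f) (W_set scale Q f)"
    unfolding disjoint_family_on_def P_set_def using P_set_disjoint by blast
  \<comment> \<open>From \<open>g\<close> below \<open>h\<close> it would follow that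
    \<open>Mov g\<close> lies in both \<open>W\<close> and \<open>W'\<close>. The opposite relation
    is excluded by exchanging the roles of \<open>W\<close> and \<open>W'\<close>.\<close>
  moreover have "\<not> refl_le scale Q g h"
    if "W \<in> W_set scale Q f" "W' \<in> W_set scale Q f" "W \<noteq> W'"
      "g \<in> P_set scale Q f W" "h \<in> P_set scale Q f W'" for W W' g h
    using that Mov_mono_open_interval[of g h] P_set_disjoint[of W W' g]
    by (auto simp: P_set_def)
  ultimately show ?thesis by (metis (no_types, lifting))
qed

end
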